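(* $\mathbf{I}\mathbb{N}_{\infty}$, the semigroup of all partial cofinite isometries of $\mathbb{N}$, is an $E$-unitary inverse semigroup.
   Context: $\mathbb{N}=\{1,2,3,\ldots\}$ with the metric $d(n,m)=|n-m|$. $\mathbf{I}\mathbb{N}_{\infty}$ is the set of all partial maps $\alpha:\mathbb{N}\rightharpoonup\mathbb{N}$ such that $\mathbb{N}\setminus\operatorname{dom}\alpha$ and $\mathbb{N}\setminus\operatorname{ran}\alpha$ are finite and $|(x)\alpha-(y)\alpha|=|x-y|$ for all $x,y\in\operatorname{dom}\alpha$, with composition of partial maps written left to right: $(x)(\alpha\beta)=((x)\alpha)\beta$, $\operatorname{dom}(\alpha\beta)=\{x\in\operatorname{dom}\alpha:(x)\alpha\in\operatorname{dom}\beta\}$. A semigroup $S$ is inverse if for every $x\in S$ there is a unique $x^{-1}\in S$ with $xx^{-1}x=x$ and $x^{-1}xx^{-1}=x^{-1}$. An inverse semigroup $S$ is $E$-unitary if, whenever $ex$ is an idempotent for some idempotent $e\in S$ and some $x\in S$, the element $x$ is an idempotent. *)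

theory Defs
  imports Main
begin

text \<open>Semigroup notions relative to a carrier set, since partial cofinite isometries form
  a proper subset of the type of partial maps.\<close>

locale semigroup_on =
  fixes S :: "'a set" and mul :: "'a \<Rightarrow> 'a \<Rightarrow> 'a" (infixl \<open>\<cdot>\<close> 70)
  assumes mul_closed: "\<lbrakk>x \<in> S; y \<in> S\<rbrakk> \<Longrightarrow> x \<cdot> y \<in> S"
    and mul_assoc: "\<lbrakk>x \<in> S; y \<in> S; z \<in> S\<rbrakk> \<Longrightarrow> (x \<cdot> y) \<cdot> z = x \<cdot> (y \<cdot> z)"
begin

definition idempotent :: "'a \<Rightarrow> bool" where
  "idempotent x \<longleftrightarrow> x \<cdot> x = x"

end

locale inverse_semigroup = semigroup_on +
  assumes ex1_inverse: "x \<in> S \<Longrightarrow> \<exists>!y. y \<in> S \<and> x \<cdot> y \<cdot> x = x \<and> y \<cdot> x \<cdot> y = y"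

locale E_unitary_inverse_semigroup = inverse_semigroup +
  assumes E_unitary:
    "\<lbrakk>e \<in> S; x \<in> S; idempotent e; idempotent (e \<cdot> x)\<rbrakk> \<Longrightarrow> idempotent x"

text \<open>Here \<open>\<nat> = {1, 2, 3, \<dots>}\<close>, written \<open>{1..}\<close>.  Distances are computed in the integers,
  because subtraction on \<^typ>\<open>nat\<close> truncates.\<close>

definition partial_cofinite_isometries :: "(nat \<rightharpoonup> nat) set" where
  "partial_cofinite_isometries =
    {\<alpha>. dom \<alpha> \<subseteq> {1..} \<and> ran \<alpha> \<subseteq> {1..} \<and>
        finite ({1..} - dom \<alpha>) \<and> finite ({1..} - ran \<alpha>) \<and>
        (\<forall>x\<in>dom \<alpha>. \<forall>y\<in>dom \<alpha>.
          \<bar>int (the (\<alpha> x)) - int (the (\<alpha> y))\<bar> = \<bar>int x - int y\<bar>)}"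

text \<open>Maps are written to the right of their arguments, so \<open>\<alpha>\<beta>\<close> applies \<open>\<alpha>\<close> first, whereas
  \<^term>\<open>\<beta> \<circ>\<^sub>m \<alpha>\<close> is the library's right-to-left composition of partial maps.\<close>

definition pmap_mult :: "('a \<rightharpoonup> 'b) \<Rightarrow> ('b \<rightharpoonup> 'c) \<Rightarrow> ('a \<rightharpoonup> 'c)" where
  "pmap_mult \<alpha> \<beta> = \<beta> \<circ>\<^sub>m \<alpha>"

end

theory Submission
  imports Defs
begin

text \<open>
  Preserving distances forces a partial isometry to be injective, so \<open>partial_cofinite_isometries\<close>
  sits inside the symmetric inverse semigroup of partial bijections. There two partial maps are
  inverse to each other in the semigroup sense exactly when their graphs are converse relations
  (\<open>inverse_pair_iff_converse\<close>), which gives the uniqueness of inverses. The existence of inverses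
  and closure under products hold because the defining conditions are symmetric under exchanging
  domain and range, and because a partial injection sends the finite complement of a set to a
  finite set.

  For \<open>E\<close>-unitarity, an idempotent partial injection is a partial identity. If \<open>e\<close> and \<open>e\<alpha>\<close> are
  idempotent, then \<open>\<alpha>\<close> fixes every point of the domain of \<open>e\<alpha>\<close>, which is cofinite and so has at
  least two points. A point of the line is determined by its distances to two distinct
  points, so an isometry with two fixed points fixes its whole domain (\<open>fixes_two_points\<close>) and is
  therefore idempotent.
\<close>

section \<open>Partial injections\<close>

definition partial_injection :: "('a \<rightharpoonup> 'b) \<Rightarrow> bool" where
  "partial_injection \<alpha> \<longleftrightarrow> (\<forall>a b c. \<alpha> a = Some c \<longrightarrow> \<alpha> b = Some c \<longrightarrow> a = b)"

lemma partial_injectionD: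
  "\<lbrakk>partial_injection \<alpha>; \<alpha> a = Some c; \<alpha> b = Some c\<rbrakk> \<Longrightarrow> a = b"
  by (auto simp: partial_injection_def)

lemma pmap_mult_Some_iff:
  "pmap_mult \<alpha> \<beta> a = Some c \<longleftrightarrow> (\<exists>b. \<alpha> a = Some b \<and> \<beta> b = Some c)"
  by (simp add: pmap_mult_def map_comp_Some_iff)

lemma map_eqI:
  assumes "\<And>a b. \<alpha> a = Some b \<longleftrightarrow> \<beta> a = Some b"
  shows "\<alpha> = \<beta>"
proof
  show "\<alpha> a = \<beta> a" for a
    by (rule option.expand) (metis assms not_Some_eq option.sel)+
qed

lemma pmap_mult_assoc:
  "pmap_mult (pmap_mult \<alpha> \<beta>) \<gamma> = pmap_mult \<alpha> (pmap_mult \<beta> \<gamma>)"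
  by (rule map_eqI) (auto simp: pmap_mult_Some_iff)

definition converse_maps :: "('a \<rightharpoonup> 'b) \<Rightarrow> ('b \<rightharpoonup> 'a) \<Rightarrow> bool" where
  "converse_maps \<alpha> \<beta> \<longleftrightarrow> (\<forall>a b. \<beta> b = Some a \<longleftrightarrow> \<alpha> a = Some b)"

lemma converse_maps_unique:
  "\<lbrakk>converse_maps \<alpha> \<beta>; converse_maps \<alpha> \<gamma>\<rbrakk> \<Longrightarrow> \<beta> = \<gamma>"
  by (rule map_eqI) (simp add: converse_maps_def)

lemma partial_injection_has_converse:
  assumes "partial_injection \<alpha>"
  shows "\<exists>\<beta>. converse_maps \<alpha> \<beta>"
proof -
  let ?\<beta> = "\<lambda>b. if b \<in> ran \<alpha> then Some (SOME a. \<alpha> a = Some b) else None"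
  have "?\<beta> b = Some a" if "\<alpha> a = Some b" for a b
  proof -
    have "(SOME a. \<alpha> a = Some b) = a"
      using that partial_injectionD[OF assms _ that] by (rule some_equality)
    then show ?thesis
      using that by (simp add: ranI)
  qed
  moreover have "\<alpha> a = Some b" if "?\<beta> b = Some a" for a b
    using that by (auto simp: ran_def intro: someI split: if_splits)
  ultimately show ?thesis
    unfolding converse_maps_def by (intro exI[of _ ?\<beta>] allI iffI)
qed

text \<open>Reading \<open>\<alpha>\<beta>\<alpha> = \<alpha>\<close> pointwise: if \<open>\<alpha>\<close> sends \<open>a\<close> to \<open>b\<close>, then \<open>\<beta>\<close> must send \<open>b\<close> to some
  point that \<open>\<alpha>\<close> sends to \<open>b\<close>, and injectivity leaves only \<open>a\<close>. The other equation gives the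
  reverse inclusion of graphs.\<close>

lemma inverse_pair_iff_converse:
  assumes "partial_injection \<alpha>" "partial_injection \<beta>"
  shows "pmap_mult (pmap_mult \<alpha> \<beta>) \<alpha> = \<alpha> \<and> pmap_mult (pmap_mult \<beta> \<alpha>) \<beta> = \<beta>
    \<longleftrightarrow> converse_maps \<alpha> \<beta>"
proof -
  have incl: "\<delta> b = Some a"
    if "partial_injection \<gamma>" "pmap_mult (pmap_mult \<gamma> \<delta>) \<gamma> = \<gamma>" "\<gamma> a = Some b"
    for \<gamma> :: "'c \<rightharpoonup> 'd" and \<delta> :: "'d \<rightharpoonup> 'c" and a b
  proof -
    have "pmap_mult (pmap_mult \<gamma> \<delta>) \<gamma> a = Some b"
      using that by simp
    then obtain c where "\<delta> b = Some c" "\<gamma> c = Some b"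
      using \<open>\<gamma> a = Some b\<close> by (auto simp: pmap_mult_Some_iff)
    then show ?thesis
      using partial_injectionD[OF that(1) _ that(3)] by blast
  qed
  show ?thesis
  proof
    assume "pmap_mult (pmap_mult \<alpha> \<beta>) \<alpha> = \<alpha> \<and> pmap_mult (pmap_mult \<beta> \<alpha>) \<beta> = \<beta>"
    then show "converse_maps \<alpha> \<beta>"
      unfolding converse_maps_def using incl[OF assms(1)] incl[OF assms(2)] by blast
  next
    assume "converse_maps \<alpha> \<beta>"
    then have conv: "\<beta> b = Some a \<longleftrightarrow> \<alpha> a = Some b" for a b
      by (simp add: converse_maps_def)
    have "pmap_mult (pmap_mult \<alpha> \<beta>) \<alpha> = \<alpha>"
      by (rule map_eqI) (auto simp: pmap_mult_Some_iff conv)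
    moreover have "pmap_mult (pmap_mult \<beta> \<alpha>) \<beta> = \<beta>"
      by (rule map_eqI) (auto simp: pmap_mult_Some_iff conv)
    ultimately show "pmap_mult (pmap_mult \<alpha> \<beta>) \<alpha> = \<alpha> \<and> pmap_mult (pmap_mult \<beta> \<alpha>) \<beta> = \<beta>" ..
  qed
qed

text \<open>If \<open>\<alpha>\<alpha> = \<alpha>\<close> and \<open>\<alpha>\<close> sends \<open>a\<close> to \<open>b\<close>, then it also sends \<open>b\<close> to \<open>b\<close>, so \<open>a = b\<close> by
  injectivity.\<close>

lemma idempotent_iff_partial_identity:
  assumes "partial_injection \<alpha>"
  shows "pmap_mult \<alpha> \<alpha> = \<alpha> \<longleftrightarrow> (\<forall>a b. \<alpha> a = Some b \<longrightarrow> a = b)"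
proof
  assume idem: "pmap_mult \<alpha> \<alpha> = \<alpha>"
  show "\<forall>a b. \<alpha> a = Some b \<longrightarrow> a = b"
  proof (intro allI impI)
    fix a b assume "\<alpha> a = Some b"
    moreover from this have "pmap_mult \<alpha> \<alpha> a = Some b"
      using idem by simp
    ultimately have "\<alpha> b = Some b"
      by (simp add: pmap_mult_Some_iff)
    then show "a = b"
      using partial_injectionD[OF assms] \<open>\<alpha> a = Some b\<close> by blast
  qed
next
  assume "\<forall>a b. \<alpha> a = Some b \<longrightarrow> a = b"
  then show "pmap_mult \<alpha> \<alpha> = \<alpha>"
    by (intro map_eqI, unfold pmap_mult_Some_iff) blast
qed

section \<open>Cofinite isometries\<close>

lemma partial_cofinite_isometries_iff:
  "\<alpha> \<in> partial_cofinite_isometries \<longleftrightarrow>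
    dom \<alpha> \<subseteq> {1..} \<and> ran \<alpha> \<subseteq> {1..} \<and> finite ({1..} - dom \<alpha>) \<and> finite ({1..} - ran \<alpha>) \<and>
    (\<forall>x y x' y'. \<alpha> x = Some x' \<longrightarrow> \<alpha> y = Some y' \<longrightarrow>
      \<bar>int x' - int y'\<bar> = \<bar>int x - int y\<bar>)"
  unfolding partial_cofinite_isometries_def by (fastforce simp: dom_def)

lemma isometry_dist:
  assumes "\<alpha> \<in> partial_cofinite_isometries" "\<alpha> x = Some x'" "\<alpha> y = Some y'"
  shows "\<bar>int x' - int y'\<bar> = \<bar>int x - int y\<bar>"
  using assms unfolding partial_cofinite_isometries_iff by blast

lemma isometry_partial_injection:
  assumes "\<alpha> \<in> partial_cofinite_isometries"
  shows "partial_injection \<alpha>"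
  unfolding partial_injection_def
proof (intro allI impI)
  fix a b c assume "\<alpha> a = Some c" "\<alpha> b = Some c"
  then show "a = b"
    using isometry_dist[OF assms, of a c b c] by simp
qed

lemma converse_isometry:
  assumes "\<alpha> \<in> partial_cofinite_isometries" "converse_maps \<alpha> \<beta>"
  shows "\<beta> \<in> partial_cofinite_isometries"
proof -
  have conv: "\<beta> b = Some a \<longleftrightarrow> \<alpha> a = Some b" for a b
    using assms(2) by (simp add: converse_maps_def)
  then have "dom \<beta> = ran \<alpha>" "ran \<beta> = dom \<alpha>"
    by (auto simp: dom_def ran_def)
  then show ?thesis
    using assms(1) unfolding partial_cofinite_isometries_iff by (auto simp: conv)
qed

text \<open>A point missing from the range of \<open>\<alpha>\<beta>\<close> is either missing from the range of \<open>\<beta>\<close> or the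
  image under \<open>\<beta>\<close> of one of the finitely many points missing from the range of \<open>\<alpha>\<close>.\<close>

lemma cofinite_ran_mult:
  assumes "dom \<beta> \<subseteq> A" "finite (A - ran \<alpha>)" "finite (B - ran \<beta>)"
  shows "finite (B - ran (pmap_mult \<alpha> \<beta>))"
proof (rule finite_subset)
  show "B - ran (pmap_mult \<alpha> \<beta>) \<subseteq> (B - ran \<beta>) \<union> (\<lambda>b. the (\<beta> b)) ` (A - ran \<alpha>)"
  proof
    fix c assume c: "c \<in> B - ran (pmap_mult \<alpha> \<beta>)"
    show "c \<in> (B - ran \<beta>) \<union> (\<lambda>b. the (\<beta> b)) ` (A - ran \<alpha>)"
    proof (cases "c \<in> ran \<beta>")
      case True
      then obtain b where b: "\<beta> b = Some c"
        by (auto simp: ran_def)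
      then have "b \<in> A - ran \<alpha>"
        using c assms(1) by (auto simp: ran_def pmap_mult_Some_iff)
      with b show ?thesis
        by force
    qed (use c in blast)
  qed
qed (use assms in simp)

text \<open>The domain of \<open>\<alpha>\<beta>\<close> is the range of the product of the converses in the opposite order,
  so its cofiniteness is the previous lemma applied to the converses.\<close>

lemma isometry_mult_closed:
  assumes \<alpha>: "\<alpha> \<in> partial_cofinite_isometries" and \<beta>: "\<beta> \<in> partial_cofinite_isometries"
  shows "pmap_mult \<alpha> \<beta> \<in> partial_cofinite_isometries"
proof -
  obtain \<alpha>' \<beta>' where conv: "converse_maps \<alpha> \<alpha>'" "converse_maps \<beta> \<beta>'"
    using assms isometry_partial_injection partial_injection_has_converse by meson
  note \<alpha>' = converse_isometry[OF \<alpha> conv(1)] and \<beta>' = converse_isometry[OF \<beta> conv(2)]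
  have "dom (pmap_mult \<alpha> \<beta>) = ran (pmap_mult \<beta>' \<alpha>')"
    using conv by (auto simp: dom_def ran_def pmap_mult_Some_iff converse_maps_def)
  moreover have "finite ({1..} - ran (pmap_mult \<beta>' \<alpha>'))"
    using cofinite_ran_mult[of \<alpha>' "{1..}" \<beta>' "{1..}"] \<alpha>' \<beta>'
    by (simp add: partial_cofinite_isometries_iff)
  moreover have "finite ({1..} - ran (pmap_mult \<alpha> \<beta>))"
    using cofinite_ran_mult[of \<beta> "{1..}" \<alpha> "{1..}"] \<alpha> \<beta>
    by (simp add: partial_cofinite_isometries_iff)
  moreover have "dom (pmap_mult \<alpha> \<beta>) \<subseteq> {1..}" "ran (pmap_mult \<alpha> \<beta>) \<subseteq> {1..}"
  proof -
    have "dom (pmap_mult \<alpha> \<beta>) \<subseteq> dom \<alpha>" "ran (pmap_mult \<alpha> \<beta>) \<subseteq> ran \<beta>"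
      by (auto simp: dom_def ran_def pmap_mult_Some_iff)
    moreover have "dom \<alpha> \<subseteq> {1..}" "ran \<beta> \<subseteq> {1..}"
      using \<alpha> \<beta> by (simp_all add: partial_cofinite_isometries_iff)
    ultimately show "dom (pmap_mult \<alpha> \<beta>) \<subseteq> {1..}" "ran (pmap_mult \<alpha> \<beta>) \<subseteq> {1..}"
      by blast+
  qed
  moreover have "\<bar>int x' - int y'\<bar> = \<bar>int x - int y\<bar>"
    if "pmap_mult \<alpha> \<beta> x = Some x'" "pmap_mult \<alpha> \<beta> y = Some y'" for x y x' y'
    using that isometry_dist[OF \<alpha>] isometry_dist[OF \<beta>] unfolding pmap_mult_Some_iff by metis
  ultimately show ?thesis
    unfolding partial_cofinite_isometries_iff by simp
qed

lemma infinite_dom_isometry: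
  assumes "\<alpha> \<in> partial_cofinite_isometries"
  shows "infinite (dom \<alpha>)"
proof
  assume "finite (dom \<alpha>)"
  then have "finite ({1::nat..} - dom \<alpha> \<union> dom \<alpha>)"
    using assms by (simp add: partial_cofinite_isometries_iff)
  then have "finite {1::nat..}"
    by (rule rev_finite_subset) blast
  then show False
    by (simp add: infinite_Ici)
qed

text \<open>The points \<open>a\<close> and \<open>b\<close> are equidistant from \<open>u\<close> and from \<open>v\<close>. If they differed, both \<open>u\<close>
  and \<open>v\<close> would be the midpoint of \<open>a\<close> and \<open>b\<close>.\<close>

lemma fixes_two_points:
  assumes "\<alpha> \<in> partial_cofinite_isometries"
    and "\<alpha> u = Some u" "\<alpha> v = Some v" "u \<noteq> v"
    and "\<alpha> a = Some b"
  shows "a = b"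
proof -
  have "\<bar>int b - int u\<bar> = \<bar>int a - int u\<bar>" "\<bar>int b - int v\<bar> = \<bar>int a - int v\<bar>"
    using isometry_dist[OF assms(1)] assms(2,3,5) by blast+
  then show ?thesis
    using \<open>u \<noteq> v\<close> by linarith
qed

section \<open>The semigroup of partial cofinite isometries\<close>

lemma isometry_E_unitary:
  assumes e: "e \<in> partial_cofinite_isometries" and \<alpha>: "\<alpha> \<in> partial_cofinite_isometries"
    and idem: "pmap_mult e e = e" "pmap_mult (pmap_mult e \<alpha>) (pmap_mult e \<alpha>) = pmap_mult e \<alpha>"
  shows "pmap_mult \<alpha> \<alpha> = \<alpha>"
proof -
  note e\<alpha> = isometry_mult_closed[OF e \<alpha>]
  have e_id: "a = b" if "e a = Some b" for a b
    using that idem(1) idempotent_iff_partial_identity isometry_partial_injection[OF e] by blast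
  have e\<alpha>_id: "a = b" if "pmap_mult e \<alpha> a = Some b" for a b
    using that idem(2) idempotent_iff_partial_identity isometry_partial_injection[OF e\<alpha>] by blast
  have fixed: "\<alpha> u = Some u" if u: "u \<in> dom (pmap_mult e \<alpha>)" for u
  proof -
    obtain c where c: "pmap_mult e \<alpha> u = Some c"
      using u by blast
    then obtain b where "e u = Some b" "\<alpha> b = Some c"
      by (auto simp: pmap_mult_Some_iff)
    then show ?thesis
      using e_id e\<alpha>_id c by metis
  qed
  have inf: "infinite (dom (pmap_mult e \<alpha>))"
    by (rule infinite_dom_isometry[OF e\<alpha>])
  obtain u where u: "u \<in> dom (pmap_mult e \<alpha>)"
    using inf by (metis ex_in_conv finite.emptyI)
  obtain v where v: "v \<in> dom (pmap_mult e \<alpha>)" "u \<noteq> v"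
    using inf finite_subset[of "dom (pmap_mult e \<alpha>)" "{u}"] by auto
  show ?thesis
    using idempotent_iff_partial_identity[OF isometry_partial_injection[OF \<alpha>]]
      fixes_two_points[OF \<alpha> fixed[OF u] fixed[OF v(1)] v(2)] by blast
qed

theorem mainTheorem3:
  shows "E_unitary_inverse_semigroup partial_cofinite_isometries pmap_mult"
proof -
  interpret semigroup_on partial_cofinite_isometries pmap_mult
    by standard (simp_all add: isometry_mult_closed pmap_mult_assoc)
  show ?thesis
  proof
    fix \<alpha> assume \<alpha>: "\<alpha> \<in> partial_cofinite_isometries"
    note inj = isometry_partial_injection
    obtain \<beta> where conv: "converse_maps \<alpha> \<beta>"
      using partial_injection_has_converse[OF inj[OF \<alpha>]] ..
    note \<beta> = converse_isometry[OF \<alpha> conv]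
    show "\<exists>!\<beta>. \<beta> \<in> partial_cofinite_isometries \<and>
        pmap_mult (pmap_mult \<alpha> \<beta>) \<alpha> = \<alpha> \<and> pmap_mult (pmap_mult \<beta> \<alpha>) \<beta> = \<beta>"
    proof (rule ex1I[of _ \<beta>])
      show "\<beta> \<in> partial_cofinite_isometries \<and>
          pmap_mult (pmap_mult \<alpha> \<beta>) \<alpha> = \<alpha> \<and> pmap_mult (pmap_mult \<beta> \<alpha>) \<beta> = \<beta>"
        using \<beta> conv inverse_pair_iff_converse[OF inj[OF \<alpha>] inj[OF \<beta>]] by blast
    next
      fix \<gamma> assume \<gamma>: "\<gamma> \<in> partial_cofinite_isometries \<and>
          pmap_mult (pmap_mult \<alpha> \<gamma>) \<alpha> = \<alpha> \<and> pmap_mult (pmap_mult \<gamma> \<alpha>) \<gamma> = \<gamma>"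
      then have "converse_maps \<alpha> \<gamma>"
        using inverse_pair_iff_converse[OF inj[OF \<alpha>], of \<gamma>] inj by blast
      then show "\<gamma> = \<beta>"
        using conv by (rule converse_maps_unique)
    qed
  next
    fix e \<alpha> assume "e \<in> partial_cofinite_isometries" "\<alpha> \<in> partial_cofinite_isometries"
      "idempotent e" "idempotent (pmap_mult e \<alpha>)"
    then show "idempotent \<alpha>"
      using isometry_E_unitary unfolding idempotent_def by blast
  qed
qed

end
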